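(* A metric space $X$ has Lipschitz dimension $0$ if and only if it has Nagata dimension $0$.
   Context: Nagata dimension: a family of subsets $\{B_i\}$ of $X$ is $D$-bounded if each $B_i$ has diameter $\le D$. For $s>0$, the family has $s$-multiplicity at most $n$ if every subset of $X$ with diameter $\le s$ meets at most $n$ members of the family. The Nagata dimension $\dim_N(X)$ is the minimal integer $n\ge0$ with the property that there exists $c>0$ such that, for all $s>0$, $X$ has a $cs$-bounded covering with $s$-multiplicity at most $n+1$ ($\infty$ if there is no such $n$). Lipschitz dimension: for $r>0$, an $r$-path in a metric space $X$ is a finite sequence $(x_1,\dots,x_k)$ in $X$ with $d(x_i,x_{i+1})\le r$ for $1\le i\le k-1$. Two points are in the same $r$-component of $X$ if some $r$-path in $X$ contains both. The $r$-components of a subset are those of the subset as a metric space. A map $f\colon X\to Y$ is Lipschitz light if there is $C>0$ such that $f$ is $C$-Lipschitz and, for every $r>0$ and every $W\subset Y$ with $\mathrm{diam}(W)\le r$, the $r$-components of $f^{-1}(W)$ have diameter at most $Cr$. The Lipschitz dimension $\dim_L(X)$ is the minimal integer $n\ge0$ such that there is a Lipschitz light map $X\to\mathbb{R}^n$ (with $\mathbb{R}^0$ a one-point space), or $\infty$ if there is none. *)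

theory Defs
  imports "HOL-Analysis.Analysis"
begin

text \<open>Metric spaces are elements of the library type \<open>'a metric\<close>: an arbitrary, possibly empty
  carrier \<open>mspace X\<close> with its distance \<open>mdist X\<close>.\<close>

text \<open>``The diameter of \<open>S\<close> is at most \<open>D\<close>'', for \<open>D \<ge> 0\<close>. This is not expressed by the library
  constant \<open>diameter\<close>, a real supremum with unspecified value on unbounded sets.\<close>

definition diam_le :: "'a metric \<Rightarrow> 'a set \<Rightarrow> real \<Rightarrow> bool" where
  "diam_le X S D \<longleftrightarrow> (\<forall>x\<in>S. \<forall>y\<in>S. mdist X x y \<le> D)"

definition bounded_family :: "'a metric \<Rightarrow> real \<Rightarrow> 'a set set \<Rightarrow> bool" where
  "bounded_family X D \<B> \<longleftrightarrow> (\<forall>B\<in>\<B>. diam_le X B D)"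

definition multiplicity_le :: "'a metric \<Rightarrow> real \<Rightarrow> 'a set set \<Rightarrow> nat \<Rightarrow> bool" where
  "multiplicity_le X s \<B> n \<longleftrightarrow>
     (\<forall>S\<subseteq>mspace X. diam_le X S s \<longrightarrow>
        finite {B\<in>\<B>. B \<inter> S \<noteq> {}} \<and> card {B\<in>\<B>. B \<inter> S \<noteq> {}} \<le> n)"

definition covering :: "'a metric \<Rightarrow> 'a set set \<Rightarrow> bool" where
  "covering X \<B> \<longleftrightarrow> \<Union>\<B> = mspace X"

definition nagata_property :: "'a metric \<Rightarrow> nat \<Rightarrow> bool" where
  "nagata_property X n \<longleftrightarrow>
     (\<exists>c>0. \<forall>s>0. \<exists>\<B>. covering X \<B> \<and> bounded_family X (c * s) \<B> \<and>
        multiplicity_le X s \<B> (n + 1))"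

definition nagata_dim :: "'a metric \<Rightarrow> enat" where
  "nagata_dim X =
     (if \<exists>n. nagata_property X n then enat (LEAST n. nagata_property X n) else \<infinity>)"

definition r_path :: "'a metric \<Rightarrow> real \<Rightarrow> 'a list \<Rightarrow> bool" where
  "r_path X r xs \<longleftrightarrow>
     set xs \<subseteq> mspace X \<and> (\<forall>i. Suc i < length xs \<longrightarrow> mdist X (xs ! i) (xs ! Suc i) \<le> r)"

definition same_r_component :: "'a metric \<Rightarrow> real \<Rightarrow> 'a \<Rightarrow> 'a \<Rightarrow> bool" where
  "same_r_component X r x y \<longleftrightarrow> (\<exists>xs. r_path X r xs \<and> x \<in> set xs \<and> y \<in> set xs)"

definition r_components :: "'a metric \<Rightarrow> real \<Rightarrow> 'a set set" where
  "r_components X r = mspace X // {(x, y). same_r_component X r x y}"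

definition lipschitz_light :: "'a metric \<Rightarrow> 'b metric \<Rightarrow> ('a \<Rightarrow> 'b) \<Rightarrow> bool" where
  "lipschitz_light X Y f \<longleftrightarrow>
     f \<in> mspace X \<rightarrow> mspace Y \<and>
     (\<exists>C>0.
        (\<forall>x\<in>mspace X. \<forall>y\<in>mspace X. mdist Y (f x) (f y) \<le> C * mdist X x y) \<and>
        (\<forall>r>0. \<forall>W\<subseteq>mspace Y. diam_le Y W r \<longrightarrow>
           (\<forall>K \<in> r_components (submetric X (f -` W \<inter> mspace X)) r. diam_le X K (C * r))))"

text \<open>Euclidean \<open>n\<close>-space has the sequences supported on \<open>{..<n}\<close> as its points (as in the
  library's topology \<open>Euclidean_space n\<close>), so that \<open>n\<close> can be quantified over; for \<open>n = 0\<close> it is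
  a single point.\<close>

definition euclidean_dist :: "nat \<Rightarrow> (nat \<Rightarrow> real) \<Rightarrow> (nat \<Rightarrow> real) \<Rightarrow> real" where
  "euclidean_dist n x y = L2_set (\<lambda>i. x i - y i) {..<n}"

definition Rn :: "nat \<Rightarrow> (nat \<Rightarrow> real) metric" where
  "Rn n = metric (topspace (Euclidean_space n), euclidean_dist n)"

lemma Metric_space_Rn: "Metric_space (topspace (Euclidean_space n)) (euclidean_dist n)"
proof
  fix x y z :: "nat \<Rightarrow> real"
  show "0 \<le> euclidean_dist n x y"
    by (simp add: euclidean_dist_def)
  show "euclidean_dist n x y = euclidean_dist n y x"
    by (simp add: euclidean_dist_def L2_set_def power2_commute)
  show "euclidean_dist n x y = 0 \<longleftrightarrow> x = y"
    if "x \<in> topspace (Euclidean_space n)" "y \<in> topspace (Euclidean_space n)"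
  proof -
    have "x = y \<longleftrightarrow> (\<forall>i<n. x i = y i)"
      using that unfolding topspace_Euclidean_space fun_eq_iff mem_Collect_eq
      by (metis not_le)
    then show ?thesis
      by (auto simp: euclidean_dist_def L2_set_eq_0_iff)
  qed
  have "euclidean_dist n x z = L2_set (\<lambda>i. (x i - y i) + (y i - z i)) {..<n}"
    by (simp add: euclidean_dist_def)
  also have "\<dots> \<le> euclidean_dist n x y + euclidean_dist n y z"
    unfolding euclidean_dist_def by (rule L2_set_triangle_ineq)
  finally show "euclidean_dist n x z \<le> euclidean_dist n x y + euclidean_dist n y z" .
qed

lemma mspace_Rn [simp]: "mspace (Rn n) = topspace (Euclidean_space n)"
  by (simp add: Rn_def Metric_space.mspace_metric [OF Metric_space_Rn])

lemma mdist_Rn [simp]: "mdist (Rn n) = euclidean_dist n"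
  by (simp add: Rn_def Metric_space.mdist_metric [OF Metric_space_Rn])

lemma mspace_Rn_0: "mspace (Rn 0) = {\<lambda>_. 0}"
  by (auto simp: topspace_Euclidean_space)

definition lipschitz_dim :: "'a metric \<Rightarrow> enat" where
  "lipschitz_dim X =
     (if \<exists>n f. lipschitz_light X (Rn n) f
      then enat (LEAST n. \<exists>f. lipschitz_light X (Rn n) f) else \<infinity>)"

end

theory Submission
  imports Defs
begin

text \<open>
  Both dimensions vanish exactly when the components of \<open>X\<close> are linearly bounded: for some
  \<open>C > 0\<close> and every \<open>r > 0\<close>, the \<open>r\<close>-components of \<open>X\<close> have diameter at most \<open>C r\<close>.

  For the Lipschitz dimension this is a matter of unfolding, since \<open>\<real>\<^sup>0\<close> is a point: the only map
  to it is Lipschitz with every positive constant, and the preimage of the point is all of \<open>X\<close>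
  (\<open>lipschitz_light_point_iff\<close>).

  For the Nagata dimension (\<open>nagata_property_0_iff\<close>), suppose first that a covering has
  \<open>s\<close>-multiplicity at most \<open>1\<close>. Two points at distance at most \<open>s\<close> form a set of diameter at most
  \<open>s\<close>, so they lie in the same member. Hence an \<open>s\<close>-path cannot leave the member
  that it starts in, and every \<open>s\<close>-component lies in one member of the covering. Conversely, the
  \<open>s\<close>-components themselves cover \<open>X\<close>, and a set of diameter at most \<open>s\<close> cannot meet two of them.
\<close>

section \<open>Components as equivalence classes\<close>

definition step_rel :: "'a metric \<Rightarrow> real \<Rightarrow> 'a rel" where
  "step_rel X r = {(x, y). x \<in> mspace X \<and> y \<in> mspace X \<and> mdist X x y \<le> r}"

lemma sym_step_rel: "sym (step_rel X r)"
  by (auto simp: step_rel_def sym_def mdist_commute)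

lemma r_path_Cons_Cons:
  "r_path X r (x # y # xs) \<longleftrightarrow> (x, y) \<in> step_rel X r \<and> r_path X r (y # xs)"
proof
  assume p: "r_path X r (x # y # xs)"
  then have "Suc i < length (y # xs) \<Longrightarrow> mdist X ((y # xs) ! i) ((y # xs) ! Suc i) \<le> r" for i
    by (auto simp: r_path_def dest: spec [of _ "Suc i"])
  with p show "(x, y) \<in> step_rel X r \<and> r_path X r (y # xs)"
    by (auto simp: r_path_def step_rel_def)
next
  assume "(x, y) \<in> step_rel X r \<and> r_path X r (y # xs)"
  then show "r_path X r (x # y # xs)"
    by (auto simp: r_path_def step_rel_def nth_Cons split: nat.splits)
qed

lemma r_path_imp_reachable_from_head:
  assumes "r_path X r (x # xs)" "y \<in> set (x # xs)"
  shows "(x, y) \<in> (step_rel X r)\<^sup>*"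
  using assms
proof (induction xs arbitrary: x)
  case Nil
  then show ?case by simp
next
  case (Cons z zs)
  then show ?case
    by (auto simp: r_path_Cons_Cons intro: converse_rtrancl_into_rtrancl)
qed

lemma reachable_imp_r_path:
  assumes "(x, y) \<in> (step_rel X r)\<^sup>*" "y \<in> mspace X"
  shows "\<exists>xs. r_path X r (x # xs) \<and> y \<in> set (x # xs)"
  using assms(1)
proof (induction rule: converse_rtrancl_induct)
  case base
  have "r_path X r [y]"
    using assms(2) by (simp add: r_path_def)
  then show ?case
    by (intro exI [of _ "[]"]) simp
next
  case (step x z)
  then obtain xs where "r_path X r (z # xs)" "y \<in> set (z # xs)"
    by blast
  with step.hyps(1) show ?case
    by (intro exI [of _ "z # xs"]) (simp add: r_path_Cons_Cons)
qed

text \<open>The two points may occur anywhere on the path and in either order, so each of them is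
  joined to the first point of the path, and the symmetry of a step turns one half around.\<close>

lemma same_r_component_iff_reachable:
  "same_r_component X r x y \<longleftrightarrow>
     x \<in> mspace X \<and> y \<in> mspace X \<and> (x, y) \<in> (step_rel X r)\<^sup>*"
proof
  assume "same_r_component X r x y"
  then obtain xs where xs: "r_path X r xs" "x \<in> set xs" "y \<in> set xs"
    by (auto simp: same_r_component_def)
  then obtain z zs where [simp]: "xs = z # zs"
    by (cases xs) auto
  have "(z, x) \<in> (step_rel X r)\<^sup>*" "(z, y) \<in> (step_rel X r)\<^sup>*"
    using r_path_imp_reachable_from_head xs by simp_all
  then have "(x, y) \<in> (step_rel X r)\<^sup>*"
    by (meson rtrancl_trans sym_rtrancl sym_step_rel symD)
  with xs show "x \<in> mspace X \<and> y \<in> mspace X \<and> (x, y) \<in> (step_rel X r)\<^sup>*"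
    unfolding r_path_def by blast
next
  assume "x \<in> mspace X \<and> y \<in> mspace X \<and> (x, y) \<in> (step_rel X r)\<^sup>*"
  then show "same_r_component X r x y"
    using reachable_imp_r_path [of x y X r] unfolding same_r_component_def
    by (meson list.set_intros(1))
qed

lemma equiv_same_r_component: "equiv (mspace X) {(x, y). same_r_component X r x y}"
proof (rule equivI)
  show "sym {(x, y). same_r_component X r x y}"
    by (auto simp: same_r_component_def sym_def)
  show "trans {(x, y). same_r_component X r x y}"
    by (auto simp: same_r_component_iff_reachable trans_def)
qed (auto simp: same_r_component_iff_reachable refl_on_def)

lemma same_r_component_if_close:
  assumes "x \<in> mspace X" "y \<in> mspace X" "mdist X x y \<le> r"
  shows "same_r_component X r x y"
  using assms by (auto simp: same_r_component_iff_reachable step_rel_def)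

section \<open>Linearly bounded components\<close>

definition linearly_bounded_components :: "'a metric \<Rightarrow> real \<Rightarrow> bool" where
  "linearly_bounded_components X C \<longleftrightarrow>
     (\<forall>r>0. \<forall>K\<in>r_components X r. diam_le X K (C * r))"

text \<open>The pointwise form suits path arguments, where two points joined by a path are given
  rather than a component.\<close>

lemma linearly_bounded_components_iff:
  "linearly_bounded_components X C \<longleftrightarrow>
     (\<forall>r>0. \<forall>x y. same_r_component X r x y \<longrightarrow> mdist X x y \<le> C * r)"
proof -
  have "(\<forall>K\<in>r_components X r. diam_le X K D) \<longleftrightarrow>
      (\<forall>x y. same_r_component X r x y \<longrightarrow> mdist X x y \<le> D)" for r D
  proof
    assume L: "\<forall>K\<in>r_components X r. diam_le X K D"
    show "\<forall>x y. same_r_component X r x y \<longrightarrow> mdist X x y \<le> D"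
    proof (intro allI impI)
      fix x y assume xy: "same_r_component X r x y"
      define K where "K = {(x, y). same_r_component X r x y} `` {x}"
      have x: "x \<in> mspace X"
        using xy by (simp add: same_r_component_iff_reachable)
      then have "K \<in> r_components X r"
        unfolding r_components_def K_def by (rule quotientI)
      moreover have "x \<in> K"
        unfolding K_def by (rule equiv_class_self [OF equiv_same_r_component x])
      moreover have "y \<in> K"
        using xy by (simp add: K_def)
      ultimately show "mdist X x y \<le> D"
        using L unfolding diam_le_def by blast
    qed
  next
    assume R: "\<forall>x y. same_r_component X r x y \<longrightarrow> mdist X x y \<le> D"
    have "same_r_component X r x y" if "K \<in> r_components X r" "x \<in> K" "y \<in> K" for K x y
      using quotient_eq_iff [OF equiv_same_r_component, of K X r K x y] that
      by (simp add: r_components_def)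
    with R show "\<forall>K\<in>r_components X r. diam_le X K D"
      unfolding diam_le_def by blast
  qed
  then show ?thesis
    by (simp add: linearly_bounded_components_def)
qed

section \<open>Lipschitz dimension zero\<close>

lemma mdist_self: "x \<in> mspace X \<Longrightarrow> mdist X x x = 0"
  by (rule Metric_space.mdist_zero [OF Metric_space_mspace_mdist])

text \<open>Only \<open>W = {p}\<close> carries information: for \<open>W = {}\<close> the preimage is empty and has no
  components.\<close>

lemma lipschitz_light_point_iff:
  assumes Y: "mspace Y = {p}"
  shows "(\<exists>f. lipschitz_light X Y f) \<longleftrightarrow> (\<exists>C>0. linearly_bounded_components X C)"
proof
  assume "\<exists>f. lipschitz_light X Y f"
  then obtain f where f: "lipschitz_light X Y f"
    by blast
  then have map: "f \<in> mspace X \<rightarrow> mspace Y"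
    by (simp add: lipschitz_light_def)
  from f obtain C where "C > 0"
    and light: "\<forall>r>0. \<forall>W\<subseteq>mspace Y. diam_le Y W r \<longrightarrow>
      (\<forall>K\<in>r_components (submetric X (f -` W \<inter> mspace X)) r. diam_le X K (C * r))"
    unfolding lipschitz_light_def by (elim conjE exE) (rule that)
  have "submetric X (f -` {p} \<inter> mspace X) = X"
  proof -
    have "f -` {p} \<inter> mspace X = mspace X"
      using map Y by auto
    then show ?thesis
      by simp
  qed
  moreover have "diam_le Y {p} r" if "r > 0" for r
    using that Y by (simp add: diam_le_def mdist_self)
  ultimately have "linearly_bounded_components X C"
    using light Y unfolding linearly_bounded_components_def by (metis order_refl)
  with \<open>C > 0\<close> show "\<exists>C>0. linearly_bounded_components X C"
    by blast
next
  assume "\<exists>C>0. linearly_bounded_components X C"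
  then obtain C where "C > 0" and C: "linearly_bounded_components X C"
    by blast
  have "\<forall>K\<in>r_components (submetric X ((\<lambda>_. p) -` W \<inter> mspace X)) r. diam_le X K (C * r)"
    if "r > 0" "W \<subseteq> mspace Y" for r W
  proof (cases "p \<in> W")
    case True
    then have "submetric X ((\<lambda>_. p) -` W \<inter> mspace X) = X"
      by simp
    then show ?thesis
      using C \<open>r > 0\<close> by (simp add: linearly_bounded_components_def)
  next
    case False
    then show ?thesis
      by (simp add: r_components_def)
  qed
  then have "lipschitz_light X Y (\<lambda>_. p)"
    unfolding lipschitz_light_def using \<open>C > 0\<close> Y
    by (auto simp: mdist_self intro!: exI [of _ C])
  then show "\<exists>f. lipschitz_light X Y f"
    by blast
qed

lemma least_enat_eq_0_iff:
  "(if \<exists>n. P n then enat (LEAST n. P n) else \<infinity>) = 0 \<longleftrightarrow> P 0"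
proof
  assume *: "(if \<exists>n. P n then enat (LEAST n. P n) else \<infinity>) = 0"
  then have ex: "\<exists>n. P n"
    by (metis infinity_ne_i0)
  with * have "(LEAST n. P n) = 0"
    by (simp add: zero_enat_def)
  with ex show "P 0"
    using LeastI_ex [of P] by simp
next
  assume "P 0"
  then show "(if \<exists>n. P n then enat (LEAST n. P n) else \<infinity>) = 0"
    using Least_eq_0 [of P] by (auto simp: zero_enat_def)
qed

lemma lipschitz_dim_eq_0_iff: "lipschitz_dim X = 0 \<longleftrightarrow> (\<exists>f. lipschitz_light X (Rn 0) f)"
  unfolding lipschitz_dim_def by (rule least_enat_eq_0_iff)

section \<open>Nagata dimension zero\<close>

text \<open>A set of small diameter meets at most one member, so consecutive points of an \<open>s\<close>-path
  lie in the same member.\<close>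

lemma reachable_stays_in_member:
  assumes cov: "covering X \<B>" and mult: "multiplicity_le X s \<B> 1" and "s \<ge> 0"
    and "(x, y) \<in> (step_rel X s)\<^sup>*" and B: "B \<in> \<B>" "x \<in> B"
  shows "y \<in> B"
  using assms(4)
proof (induction rule: rtrancl_induct)
  case base
  show ?case by (rule B)
next
  case (step y z)
  then have yz: "y \<in> mspace X" "z \<in> mspace X" "mdist X y z \<le> s"
    by (auto simp: step_rel_def)
  obtain B' where B': "B' \<in> \<B>" "z \<in> B'"
    using cov yz(2) unfolding covering_def by blast
  have "diam_le X {y, z} s"
    using yz \<open>s \<ge> 0\<close> by (simp add: diam_le_def mdist_commute mdist_self)
  then have "finite {A\<in>\<B>. A \<inter> {y, z} \<noteq> {}}" "card {A\<in>\<B>. A \<inter> {y, z} \<noteq> {}} \<le> 1"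
    using mult [unfolded multiplicity_le_def, THEN spec, of "{y, z}"] yz(1,2) by blast+
  moreover have "B \<in> {A\<in>\<B>. A \<inter> {y, z} \<noteq> {}}" "B' \<in> {A\<in>\<B>. A \<inter> {y, z} \<noteq> {}}"
    using B B' step.IH by auto
  ultimately have "B = B'"
    unfolding One_nat_def using card_le_Suc0_iff_eq by blast
  with B' show ?case
    by simp
qed

lemma covering_r_components: "covering X (r_components X r)"
  unfolding covering_def r_components_def
  by (rule Union_quotient [OF equiv_same_r_component])

text \<open>Any two points of a set of diameter at most \<open>s\<close> form an \<open>s\<close>-path, so a
  nonempty such set lies in a single component.\<close>

lemma multiplicity_r_components: "multiplicity_le X s (r_components X s) 1"
  unfolding multiplicity_le_def
proof (intro allI impI)
  fix S assume S: "S \<subseteq> mspace X" "diam_le X S s"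
  have eq: "K = L" if K: "K \<in> r_components X s" "x \<in> K" "x \<in> S"
    and L: "L \<in> r_components X s" "y \<in> L" "y \<in> S" for K L x y
  proof -
    have "same_r_component X s x y"
      using S K(3) L(3) by (intro same_r_component_if_close) (auto simp: diam_le_def)
    then show ?thesis
      using quotient_eqI [OF equiv_same_r_component, of K X s L x y] K(1,2) L(1,2)
      by (simp add: r_components_def)
  qed
  let ?M = "{K \<in> r_components X s. K \<inter> S \<noteq> {}}"
  have "K = L" if "K \<in> ?M" "L \<in> ?M" for K L
  proof -
    from that obtain x y where "x \<in> K" "x \<in> S" "y \<in> L" "y \<in> S"
      by auto
    with that show ?thesis
      using eq [of K x L y] by simp
  qed
  then have "?M \<subseteq> {K}" if "K \<in> ?M" for K
    using that by (intro subsetI) simp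
  then obtain K where "?M \<subseteq> {K}"
    by (cases "?M = {}") (auto simp del: mem_Collect_eq)
  then show "finite ?M \<and> card ?M \<le> 1"
    using card_mono [of "{K}" ?M] finite_subset [of ?M "{K}"] by simp
qed

lemma nagata_property_0_iff:
  "nagata_property X 0 \<longleftrightarrow> (\<exists>C>0. linearly_bounded_components X C)"
proof
  assume "nagata_property X 0"
  then obtain c where "c > 0" and c: "\<And>s. s > 0 \<Longrightarrow>
      \<exists>\<B>. covering X \<B> \<and> bounded_family X (c * s) \<B> \<and> multiplicity_le X s \<B> 1"
    unfolding nagata_property_def by auto
  have "mdist X x y \<le> c * r" if "r > 0" and xy: "same_r_component X r x y" for r x y
  proof -
    obtain \<B> where \<B>: "covering X \<B>" "bounded_family X (c * r) \<B>" "multiplicity_le X r \<B> 1"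
      using c \<open>r > 0\<close> by blast
    have x: "x \<in> mspace X" and reach: "(x, y) \<in> (step_rel X r)\<^sup>*"
      using xy by (simp_all add: same_r_component_iff_reachable)
    obtain B where B: "B \<in> \<B>" "x \<in> B"
      using \<B>(1) x unfolding covering_def by blast
    then have "y \<in> B"
      using reachable_stays_in_member [OF \<B>(1,3) _ reach] \<open>r > 0\<close> by simp
    then show ?thesis
      using B \<B>(2) by (auto simp: bounded_family_def diam_le_def)
  qed
  with \<open>c > 0\<close> show "\<exists>C>0. linearly_bounded_components X C"
    by (auto simp: linearly_bounded_components_iff)
next
  assume "\<exists>C>0. linearly_bounded_components X C"
  then obtain C where "C > 0" and C: "linearly_bounded_components X C"
    by blast
  have "covering X (r_components X s) \<and> bounded_family X (C * s) (r_components X s) \<and>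
      multiplicity_le X s (r_components X s) (0 + 1)" if "s > 0" for s
    using that C covering_r_components [of X s] multiplicity_r_components [of X s]
    by (simp add: linearly_bounded_components_def bounded_family_def)
  with \<open>C > 0\<close> show "nagata_property X 0"
    unfolding nagata_property_def by blast
qed

lemma nagata_dim_eq_0_iff: "nagata_dim X = 0 \<longleftrightarrow> nagata_property X 0"
  unfolding nagata_dim_def by (rule least_enat_eq_0_iff)

theorem proposition6p3:
  fixes X :: "'a metric"
  shows "lipschitz_dim X = 0 \<longleftrightarrow> nagata_dim X = 0"
  by (simp only: lipschitz_dim_eq_0_iff nagata_dim_eq_0_iff
      lipschitz_light_point_iff [OF mspace_Rn_0] nagata_property_0_iff)

end
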